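(* Let $K\ge1$, $M\ge K$, $\mathcal K=\{1,\dots,K\}$, let $\mathcal K'\subseteq\mathcal K$ be a fixed nonempty set with $|\mathcal K'|=K'$, and let $r\ge0$, $\rho>0$, $P_{\mathrm{IT}}>0$, $P_{\mathrm{LO}}>0$, $P_{\mathrm{RF}}>0$ and $\sigma_k^2>0$, $\chi_k>0$ ($k\in\mathcal K$) be constants independent of $N$ (as are $K$ and $M$). For each $N\ge1$ let $\mathbf h_k=\mathbf h_k^{(N)}\in\mathbb C^N$ ($k\in\mathcal K$) be random channels such that $\frac1N\|\mathbf h_k\|_2^2\to\chi_k$ almost surely as $N\to\infty$, and put $\omega_k=\|\mathbf h_k\|_2^2/\sigma_k^2$. Define $$P_{\mathrm{cir}}^{\mathrm{DBF}}=P_{\mathrm{LO}}+NP_{\mathrm{RF}},\qquad P_{\mathrm{cir}}^{\mathrm{TLM}}=P_{\mathrm{LO}}+KP_{\mathrm{RF}}+\Big(\frac{(K+N)(K+N+1)}2+K(2K+1)\Big)P_{\mathrm{IT}},$$ $$P_{\mathrm{cir}}^{\mathrm{HDM}}=P_{\mathrm{LO}}+MP_{\mathrm{RF}}+\frac{(M+N)(M+N+1)}2P_{\mathrm{IT}},$$ and, for $g\in\{\mathrm{DBF},\mathrm{TLM},\mathrm{HDM}\}$, $$A^g=P_{\mathrm{cir}}^{g}+\frac1\rho\sum_{k\notin\mathcal K'}\frac{2^r-1}{\omega_k}-\frac1\rho\sum_{k\in\mathcal K'}\frac1{\omega_k},\qquad B=(K-K')r+\sum_{k\in\mathcal K'}\log_2(\omega_k)+K'\log_2\!\Big(\frac\rho{\ln2}\Big),$$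 $$\eta^{g}=\frac{K'}{A^g\ln2}\,W\!\left(\frac{A^g\ln2}{K'}\exp\!\Big(\frac{B\ln2}{K'}-1\Big)\right),$$ where $W$ is the principal branch of the Lambert function. Then $\eta^{\mathrm{DBF}}$ scales as $\ln(N)/N$ with factor $\frac{2K'}{P_{\mathrm{RF}}\ln2}$, and $\eta^{\mathrm{TLM}},\eta^{\mathrm{HDM}}$ scale as $\ln(N)/N^2$ with factor $\frac{6K'}{P_{\mathrm{IT}}\ln2}$; that is, almost surely, $$\lim_{N\to\infty}\frac{N}{\ln N}\,\eta^{\mathrm{DBF}}=\frac{2K'}{P_{\mathrm{RF}}\ln2},\qquad \lim_{N\to\infty}\frac{N^2}{\ln N}\,\eta^{\mathrm{TLM}}=\lim_{N\to\infty}\frac{N^2}{\ln N}\,\eta^{\mathrm{HDM}}=\frac{6K'}{P_{\mathrm{IT}}\ln2}.$$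
   Context: $\eta^{g}$ is the optimal energy efficiency of architecture $g$ with $N$ transmit antennas and $K$ users, under orthogonal user channels and no quantization noise, expressed through the set $\mathcal K'$ of users whose rate strictly exceeds the minimum rate $r$. DBF is fully digital beamforming (one RF chain per antenna), TLM is the two-layer microwave linear analog computer ($K$ RF chains), HDM is the hybrid digital microwave linear analog computer ($M$ RF chains). $P_{\mathrm{LO}}$ is the local oscillator power, $P_{\mathrm{RF}}=P_{\mathrm H}+2(P_{\mathrm{VGA}}+P_{\mathrm M}+P_{\mathrm{LP}}+P_{\mathrm{ADC}})$ the power of one RF chain, $P_{\mathrm{IT}}$ the power of one impedance tuning element, $\rho$ the power amplifier efficiency. For all sufficiently large $N$ one has $\omega_k>0$ and $A^g>0$ almost surely, so $\eta^g$ is well defined. *)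

theory Defs
  imports "HOL-Probability.Probability"
begin

(* Principal real branch W0 of the Lambert function.  The defining property
   determines w uniquely exactly when x >= -1/e; other arguments give an
   unspecified value. *)
definition lambert_W :: "real \<Rightarrow> real" where
  "lambert_W x = (THE w. w \<ge> -1 \<and> w * exp w = x)"

datatype arch = DBF | TLM | HDM

(* circuit_power PLO PRF PIT K M g N: K users, M RF chains (relevant for HDM
   only), N transmit antennas. *)
fun circuit_power :: "real \<Rightarrow> real \<Rightarrow> real \<Rightarrow> nat \<Rightarrow> nat \<Rightarrow> arch \<Rightarrow> nat \<Rightarrow> real" where
  "circuit_power PLO PRF PIT K M DBF N = PLO + real N * PRF"
| "circuit_power PLO PRF PIT K M TLM N =
     PLO + real K * PRF
     + (real ((K + N) * (K + N + 1)) / 2 + real (K * (2 * K + 1))) * PIT"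
| "circuit_power PLO PRF PIT K M HDM N =
     PLO + real M * PRF + real ((M + N) * (M + N + 1)) / 2 * PIT"

(* A vector of C^N is a function nat => complex read on the indices 1..N,
   since N varies within the statement. *)
definition norm2 :: "nat \<Rightarrow> (nat \<Rightarrow> complex) \<Rightarrow> real" where
  "norm2 N v = L2_set (\<lambda>i. cmod (v i)) {1..N}"

(* For fixed N, the family (h k) of channels and the noise deviations (\<sigma> k). *)
definition omega :: "nat \<Rightarrow> (nat \<Rightarrow> real) \<Rightarrow> (nat \<Rightarrow> nat \<Rightarrow> complex) \<Rightarrow> nat \<Rightarrow> real" where
  "omega N \<sigma> h k = (norm2 N (h k))\<^sup>2 / (\<sigma> k)\<^sup>2"

(* In A_coef, B_coef and eta_opt, S is the set K' of users above the minimum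
   rate and w is the family of the omega_k. *)
definition A_coef ::
  "real \<Rightarrow> real \<Rightarrow> real \<Rightarrow> nat \<Rightarrow> nat set \<Rightarrow> (nat \<Rightarrow> real) \<Rightarrow> real" where
  "A_coef Pcir \<rho> r K S w =
     Pcir + 1 / \<rho> * (\<Sum>k\<in>{1..K} - S. (2 powr r - 1) / w k)
          - 1 / \<rho> * (\<Sum>k\<in>S. 1 / w k)"

definition B_coef :: "real \<Rightarrow> real \<Rightarrow> nat \<Rightarrow> nat set \<Rightarrow> (nat \<Rightarrow> real) \<Rightarrow> real" where
  "B_coef \<rho> r K S w =
     (real K - real (card S)) * r + (\<Sum>k\<in>S. log 2 (w k))
     + real (card S) * log 2 (\<rho> / ln 2)"

definition eta_opt ::
  "real \<Rightarrow> real \<Rightarrow> real \<Rightarrow> nat \<Rightarrow> nat set \<Rightarrow> (nat \<Rightarrow> real) \<Rightarrow> real" where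
  "eta_opt Pcir \<rho> r K S w =
     (let A = A_coef Pcir \<rho> r K S w; B = B_coef \<rho> r K S w; K' = real (card S)
      in K' / (A * ln 2) * lambert_W (A * ln 2 / K' * exp (B * ln 2 / K' - 1)))"

end

theory Submission
  imports Defs "HOL-Real_Asymp.Real_Asymp"
begin

text \<open>Since \<open>W(x) \<sim> ln x\<close> and the argument of \<open>W\<close> has the exact order
  \<open>N ^ (d + 1)\<close> when the circuit power has the exact order \<open>N ^ d\<close> (one
  further factor \<open>N\<close> is the geometric mean of the \<open>\<omega>\<^sub>k\<close>), the Lambert factor
  is asymptotic to \<open>(d + 1) * ln N\<close>.  The limit is then \<open>(d + 1) * K' / (c * ln 2)\<close>
  with \<open>c\<close> the leading coefficient of the circuit power.\<close>

text \<open>The map \<open>w * exp w\<close> is 0 at 0 and at least \<open>x\<close> at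
  \<open>w = x\<close>, so it takes the value \<open>x\<close> in between. A solution for positive
  \<open>x\<close> must itself be positive, where the map is strictly increasing. Hence the solution
  is unique and the description in \<open>lambert_W_def\<close> denotes it.\<close>

lemma
  assumes "x > 0"
  shows lambert_W_pos: "lambert_W x > 0"
    and lambert_W_times_exp: "lambert_W x * exp (lambert_W x) = x"
proof -
  have "\<exists>w. 0 \<le> w \<and> w \<le> x \<and> w * exp w = x"
  proof (rule IVT)
    have "1 \<le> exp x" using assms by simp
    then show "x \<le> x * exp x" using assms by simp
  qed (use assms in auto)
  then obtain w where w: "0 \<le> w" "w * exp w = x" by blast
  have "w > 0" using w assms by (cases "w = 0") auto
  have "v = w" if v: "v * exp v = x" for v
  proof -
    have "v > 0" using v assms by (metis exp_gt_zero zero_less_mult_pos2)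
    have "\<not> v < w" and "\<not> w < v"
      using mult_strict_mono[of v w "exp v" "exp w"] mult_strict_mono[of w v "exp w" "exp v"]
        v w \<open>v > 0\<close> \<open>w > 0\<close> by auto
    then show ?thesis by linarith
  qed
  moreover have "w \<ge> -1 \<and> w * exp w = x" using w by simp
  ultimately have "lambert_W x = w"
    unfolding lambert_W_def by (intro the_equality) blast+
  then show "lambert_W x > 0" "lambert_W x * exp (lambert_W x) = x"
    using w \<open>w > 0\<close> by auto
qed

text \<open>Taking logarithms in \<open>w * exp w = x\<close> gives \<open>ln x = ln w + w\<close>.
  Since \<open>ln w\<close> is nonnegative this bounds \<open>w\<close> by \<open>ln x\<close>, and
  feeding that bound back into \<open>ln w\<close> gives the lower estimate.\<close>

lemma lambert_W_bounds:
  assumes "x \<ge> exp 1"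
  shows "lambert_W x \<le> ln x" "ln x - ln (ln x) \<le> lambert_W x"
proof -
  have x: "x > 0" using assms by (meson exp_gt_zero less_le_trans)
  define w where "w = lambert_W x"
  have w: "w > 0" "w * exp w = x"
    using lambert_W_pos[OF x] lambert_W_times_exp[OF x] by (auto simp: w_def)
  \<comment> \<open>The threshold \<open>exp 1\<close> is the value of \<open>w * exp w\<close> at
    \<open>w = 1\<close>, so a smaller \<open>w\<close> would give a smaller product.\<close>
  have "w \<ge> 1"
  proof (rule ccontr)
    assume "\<not> w \<ge> 1"
    then have "w * exp w < 1 * exp 1" using w by (intro mult_strict_mono) auto
    then show False using w assms by simp
  qed
  have "ln x = ln w + w" using w by (metis exp_gt_zero ln_exp ln_mult_pos)
  moreover have "ln w \<ge> 0" using \<open>w \<ge> 1\<close> by simp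
  ultimately have "w \<le> ln x" by simp
  then have "ln w \<le> ln (ln x)" using w by simp
  show "lambert_W x \<le> ln x" "ln x - ln (ln x) \<le> lambert_W x"
    using \<open>w \<le> ln x\<close> \<open>ln w \<le> ln (ln x)\<close> \<open>ln x = ln w + w\<close> by (auto simp: w_def)
qed

text \<open>The two bounds differ by \<open>ln (ln x)\<close>, which is negligible against
  \<open>ln x\<close>.\<close>

lemma lambert_W_over_ln_tendsto: "((\<lambda>x. lambert_W x / ln x) \<longlongrightarrow> 1) at_top"
proof (rule tendsto_sandwich[of "\<lambda>x. (ln x - ln (ln x)) / ln x" _ _ "\<lambda>_. 1"])
  show "((\<lambda>x::real. (ln x - ln (ln x)) / ln x) \<longlongrightarrow> 1) at_top" by real_asymp
  have ln_pos: "ln x > 0" if "x \<ge> exp 1" for x :: real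
    using that ln_ge_iff[of x 1] by (smt (verit) exp_gt_zero)
  show "\<forall>\<^sub>F x in at_top. (ln x - ln (ln x)) / ln x \<le> lambert_W x / ln x"
    using eventually_ge_at_top[of "exp 1 :: real"]
    by eventually_elim (simp add: divide_right_mono lambert_W_bounds(2) less_imp_le[OF ln_pos])
  show "\<forall>\<^sub>F x in at_top. lambert_W x / ln x \<le> 1"
    using eventually_ge_at_top[of "exp 1 :: real"]
    by eventually_elim (simp add: divide_le_eq_1_pos lambert_W_bounds(1) ln_pos)
qed simp

text \<open>Writes \<open>f\<close> as a divergent power times a factor with positive limit. It
  serves both the \<omega> of each user, with exponent 1, and the argument of the Lambert
  function.\<close>

lemma filterlim_real_power_at_top:
  fixes f :: "nat \<Rightarrow> real"
  assumes "(\<lambda>N. f N / real N ^ d) \<longlonglongrightarrow> c" "c > 0" "d > 0"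
  shows "filterlim f at_top sequentially"
proof -
  have "filterlim (\<lambda>N. real N ^ d) at_top sequentially"
    using \<open>d > 0\<close> by (intro filterlim_pow_at_top filterlim_real_sequentially)
  then have "filterlim (\<lambda>N. (f N / real N ^ d) * real N ^ d) at_top sequentially"
    by (rule filterlim_tendsto_pos_mult_at_top[OF assms(1,2)])
  moreover have "\<forall>\<^sub>F N in sequentially. (f N / real N ^ d) * real N ^ d = f N"
    using eventually_gt_at_top[of 0] by eventually_elim simp
  ultimately show ?thesis by (simp add: filterlim_cong)
qed

text \<open>Since \<open>ln (f N) = ln (f N / N ^ d) + d * ln N\<close> and the first summand
  converges, division by \<open>ln N\<close> leaves only the exponent. The constant \<open>c\<close>
  disappears from the limit.\<close>

lemma ln_over_ln_tendsto:
  fixes f :: "nat \<Rightarrow> real"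
  assumes f: "(\<lambda>N. f N / real N ^ d) \<longlonglongrightarrow> c" and c: "c > 0"
  shows "(\<lambda>N. ln (f N) / ln (real N)) \<longlonglongrightarrow> real d"
proof -
  have "(\<lambda>N. ln (f N / real N ^ d) * (1 / ln (real N)) + real d) \<longlonglongrightarrow> ln c * 0 + real d"
    by (intro tendsto_intros f) (use c in simp, real_asymp)
  moreover have "\<forall>\<^sub>F N in sequentially.
      ln (f N / real N ^ d) * (1 / ln (real N)) + real d = ln (f N) / ln (real N)"
    using order_tendstoD(1)[OF f c] eventually_gt_at_top[of 1]
  proof eventually_elim
    case (elim N)
    then have "f N > 0" by (simp add: zero_less_divide_iff)
    then show ?case using elim
      by (simp add: ln_div ln_realpow field_simps)
  qed
  ultimately have "(\<lambda>N. ln (f N) / ln (real N)) \<longlonglongrightarrow> ln c * 0 + real d"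
    by (rule Lim_transform_eventually)
  then show ?thesis by simp
qed

text \<open>Each \<open>w N k\<close> grows linearly, so the two sums of reciprocals vanish in the
  limit and the circuit power alone fixes the leading coefficient.\<close>

lemma A_coef_tendsto:
  fixes w :: "nat \<Rightarrow> nat \<Rightarrow> real"
  assumes S: "S \<subseteq> {1..K}" and "d > 0"
    and w: "\<And>k. k \<in> {1..K} \<Longrightarrow> (\<lambda>N. w N k / real N) \<longlonglongrightarrow> a k"
    and a: "\<And>k. k \<in> {1..K} \<Longrightarrow> a k > 0"
    and P: "(\<lambda>N. P N / real N ^ d) \<longlonglongrightarrow> c"
  shows "(\<lambda>N. A_coef (P N) \<rho> r K S (w N) / real N ^ d) \<longlonglongrightarrow> c"
proof -
  have "filterlim (\<lambda>N. w N k) at_top sequentially" if "k \<in> {1..K}" for k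
    using filterlim_real_power_at_top[of "\<lambda>N. w N k" 1 "a k"] w a that by simp
  \<comment> \<open>The arbitrary numerator \<open>y\<close> covers both \<open>2 powr r - 1\<close>
    and \<open>1\<close>.\<close>
  then have inv: "(\<lambda>N. y / w N k) \<longlonglongrightarrow> 0" if "k \<in> {1..K}" for k y
    using that by (intro real_tendsto_divide_at_top[OF tendsto_const]) auto
  have "(\<lambda>N. 1 / \<rho> * (\<Sum>k\<in>{1..K} - S. (2 powr r - 1) / w N k)
          - 1 / \<rho> * (\<Sum>k\<in>S. 1 / w N k)) \<longlonglongrightarrow>
        1 / \<rho> * (\<Sum>k\<in>{1..K} - S. 0) - 1 / \<rho> * (\<Sum>k\<in>S. 0)"
    by (intro tendsto_intros inv) (use S in auto)
  moreover have "filterlim (\<lambda>N. real N ^ d) at_top sequentially"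
    using \<open>d > 0\<close> by (intro filterlim_pow_at_top filterlim_real_sequentially)
  ultimately have "(\<lambda>N. (1 / \<rho> * (\<Sum>k\<in>{1..K} - S. (2 powr r - 1) / w N k)
          - 1 / \<rho> * (\<Sum>k\<in>S. 1 / w N k)) / real N ^ d) \<longlonglongrightarrow> 0"
    by (intro real_tendsto_divide_at_top)
  from tendsto_add[OF P this] show ?thesis
    by (simp add: A_coef_def add_divide_distrib diff_divide_distrib algebra_simps)
qed

text \<open>Up to a constant factor the exponential is the geometric mean of the
  \<open>w N k\<close> over \<open>S\<close>, hence of order \<open>N\<close>. Only a positive limit
  is asserted, because its value is lost once \<open>ln_over_ln_tendsto\<close> is applied.\<close>

lemma exp_B_coef_tendsto:
  fixes w :: "nat \<Rightarrow> nat \<Rightarrow> real"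
  assumes S: "finite S" "S \<noteq> {}"
    and w: "\<And>k. k \<in> S \<Longrightarrow> (\<lambda>N. w N k / real N) \<longlonglongrightarrow> a k"
    and a: "\<And>k. k \<in> S \<Longrightarrow> a k > 0"
  obtains e where "e > 0"
    "(\<lambda>N. exp (B_coef \<rho> r K S (w N) * ln 2 / real (card S) - 1) / real N) \<longlonglongrightarrow> e"
proof -
  define K' where "K' = real (card S)"
  have K': "K' > 0" using S by (auto simp: K'_def card_gt_0_iff)
  \<comment> \<open>\<open>R\<close> collects the terms of \<open>B_coef\<close> that do not depend
    on \<open>N\<close>.\<close>
  define R where "R = (real K - K') * r + K' * log 2 (\<rho> / ln 2)"
  \<comment> \<open>Dividing by \<open>N\<close> inside each logarithm makes every term converge. It
    removes \<open>ln N / ln 2\<close> from each of the \<open>K'\<close> summands, and the factor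
    \<open>ln 2 / K'\<close> turns the total into a single \<open>ln N\<close>, that is, the
    division by \<open>N\<close> outside the exponential.\<close>
  have "(\<lambda>N. exp ((R + (\<Sum>k\<in>S. ln (w N k / real N) / ln 2)) * ln 2 / K' - 1)) \<longlonglongrightarrow>
        exp ((R + (\<Sum>k\<in>S. ln (a k) / ln 2)) * ln 2 / K' - 1)"
    by (intro tendsto_intros w) (use a K' in force)+
  moreover have "\<forall>\<^sub>F N in sequentially. \<forall>k\<in>S. w N k / real N > 0"
    using S(1) order_tendstoD(1)[OF w a] by (simp add: eventually_ball_finite)
  then have "\<forall>\<^sub>F N in sequentially.
      exp ((R + (\<Sum>k\<in>S. ln (w N k / real N) / ln 2)) * ln 2 / K' - 1) =
      exp (B_coef \<rho> r K S (w N) * ln 2 / K' - 1) / real N"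
    using eventually_gt_at_top[of 0]
  proof eventually_elim
    case (elim N)
    have "(\<Sum>k\<in>S. ln (w N k / real N) / ln 2) = (\<Sum>k\<in>S. log 2 (w N k) - ln (real N) / ln 2)"
    proof (rule sum.cong)
      fix k assume "k \<in> S"
      with elim have "w N k > 0" by (auto simp: zero_less_divide_iff)
      with elim show "ln (w N k / real N) / ln 2 = log 2 (w N k) - ln (real N) / ln 2"
        by (simp add: ln_div log_def diff_divide_distrib)
    qed simp
    also have "\<dots> = (\<Sum>k\<in>S. log 2 (w N k)) - K' * ln (real N) / ln 2"
      by (simp add: sum_subtractf K'_def)
    finally have "(R + (\<Sum>k\<in>S. ln (w N k / real N) / ln 2)) * ln 2 / K' - 1 =
        B_coef \<rho> r K S (w N) * ln 2 / K' - 1 - ln (real N)"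
      using K' by (simp add: B_coef_def R_def K'_def[symmetric] field_simps)
    then show ?case using elim by (simp add: exp_diff)
  qed
  ultimately have "(\<lambda>N. exp (B_coef \<rho> r K S (w N) * ln 2 / K' - 1) / real N) \<longlonglongrightarrow>
        exp ((R + (\<Sum>k\<in>S. ln (a k) / ln 2)) * ln 2 / K' - 1)"
    by (rule Lim_transform_eventually)
  then show ?thesis by (intro that) (auto simp: K'_def)
qed

text \<open>One statement covers all architectures: \<open>d\<close> and \<open>c\<close> are the
  order and the leading coefficient of the circuit power.\<close>

lemma eta_opt_tendsto:
  fixes w :: "nat \<Rightarrow> nat \<Rightarrow> real"
  assumes S: "S \<subseteq> {1..K}" "S \<noteq> {}" and d: "d > 0"
    and w: "\<And>k. k \<in> {1..K} \<Longrightarrow> (\<lambda>N. w N k / real N) \<longlonglongrightarrow> a k"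
    and a: "\<And>k. k \<in> {1..K} \<Longrightarrow> a k > 0"
    and P: "(\<lambda>N. P N / real N ^ d) \<longlonglongrightarrow> c" and c: "c > 0"
  shows "(\<lambda>N. real N ^ d / ln (real N) * eta_opt (P N) \<rho> r K S (w N))
           \<longlonglongrightarrow> real (d + 1) * real (card S) / (c * ln 2)"
proof -
  define K' where "K' = real (card S)"
  have fin: "finite S" using S finite_subset by blast
  have K': "K' > 0" using S fin by (auto simp: K'_def card_gt_0_iff)
  define A where "A = (\<lambda>N. A_coef (P N) \<rho> r K S (w N))"
  define E where "E = (\<lambda>N. exp (B_coef \<rho> r K S (w N) * ln 2 / K' - 1))"
  define X where "X = (\<lambda>N. A N * ln 2 / K' * E N)"
  have A: "(\<lambda>N. A N / real N ^ d) \<longlonglongrightarrow> c"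
    unfolding A_def by (rule A_coef_tendsto[OF S(1) d w a P])
  obtain e where e: "e > 0" "(\<lambda>N. E N / real N) \<longlonglongrightarrow> e"
    using exp_B_coef_tendsto[of S w a \<rho> r K] fin S w a unfolding E_def K'_def by blast
  \<comment> \<open>Of the \<open>d + 1\<close> powers of \<open>N\<close>, \<open>A\<close> absorbs
    \<open>d\<close> and the exponential \<open>E\<close> absorbs one.\<close>
  have "(\<lambda>N. A N / real N ^ d * (ln 2 / K') * (E N / real N)) \<longlonglongrightarrow> c * (ln 2 / K') * e"
    by (intro tendsto_intros A e)
  then have X: "(\<lambda>N. X N / real N ^ (d + 1)) \<longlonglongrightarrow> c * (ln 2 / K') * e"
    by (simp add: X_def field_simps)
  have X_pos: "c * (ln 2 / K') * e > 0" using c K' e by simp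
  have X_top: "filterlim X at_top sequentially"
    by (rule filterlim_real_power_at_top[OF X X_pos]) simp
  have "(\<lambda>N. lambert_W (X N) / ln (X N)) \<longlonglongrightarrow> 1"
    by (rule filterlim_compose[OF lambert_W_over_ln_tendsto X_top])
  \<comment> \<open>The scaled efficiency is split by inserting \<open>ln (X N)\<close>, so that
    every factor has a known limit: \<open>1 / c\<close> from \<open>A\<close>, \<open>1\<close>
    from the Lambert function, \<open>d + 1\<close> from the order of \<open>X\<close>.\<close>
  then have "(\<lambda>N. K' / ln 2 * (1 / (A N / real N ^ d)) * (lambert_W (X N) / ln (X N))
        * (ln (X N) / ln (real N))) \<longlonglongrightarrow> K' / ln 2 * (1 / c) * 1 * real (d + 1)"
    by (intro tendsto_intros A ln_over_ln_tendsto[OF X X_pos]) (use c in auto)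
  moreover have "\<forall>\<^sub>F N in sequentially.
      K' / ln 2 * (1 / (A N / real N ^ d)) * (lambert_W (X N) / ln (X N)) * (ln (X N) / ln (real N))
      = real N ^ d / ln (real N) * eta_opt (P N) \<rho> r K S (w N)"
    \<comment> \<open>\<open>X N > 1\<close> makes \<open>ln (X N)\<close> nonzero, so the inserted
      logarithm cancels. The other denominators may even vanish, as \<open>x / 0 = 0\<close> keeps
      both sides equal.\<close>
    using filterlim_at_top_dense[THEN iffD1, OF X_top, rule_format, of 1]
  proof eventually_elim
    case (elim N)
    have "eta_opt (P N) \<rho> r K S (w N) = K' / (A N * ln 2) * lambert_W (X N)"
      by (simp add: eta_opt_def A_def X_def E_def K'_def Let_def)
    moreover have "ln (X N) \<noteq> 0" using elim by simp
    ultimately show ?case by (simp add: mult_ac)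
  qed
  ultimately have "(\<lambda>N. real N ^ d / ln (real N) * eta_opt (P N) \<rho> r K S (w N))
      \<longlonglongrightarrow> K' / ln 2 * (1 / c) * 1 * real (d + 1)"
    by (rule Lim_transform_eventually)
  then show ?thesis by (simp add: K'_def mult.commute)
qed

theorem mainTheorem3:
  fixes \<Omega> :: "'a measure"
    and K M :: nat
    and S :: "nat set"
    and r \<rho> PIT PLO PRF :: real
    and \<sigma> chi :: "nat \<Rightarrow> real"
    and h :: "nat \<Rightarrow> nat \<Rightarrow> 'a \<Rightarrow> nat \<Rightarrow> complex"
    and \<eta> :: "arch \<Rightarrow> nat \<Rightarrow> 'a \<Rightarrow> real"
  defines "\<eta> \<equiv> \<lambda>g N x. eta_opt (circuit_power PLO PRF PIT K M g N) \<rho> r K S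
                           (omega N \<sigma> (\<lambda>k. h N k x))"
  assumes "prob_space \<Omega>"
    and "K \<ge> 1" and "M \<ge> K"
    and "S \<subseteq> {1..K}" and "S \<noteq> {}"
    and "r \<ge> 0" and "\<rho> > 0" and "PIT > 0" and "PLO > 0" and "PRF > 0"
    and "\<And>k. k \<in> {1..K} \<Longrightarrow> (\<sigma> k)\<^sup>2 > 0"
    and "\<And>k. k \<in> {1..K} \<Longrightarrow> chi k > 0"
    and "\<And>N k i. N \<ge> 1 \<Longrightarrow> k \<in> {1..K} \<Longrightarrow> i \<in> {1..N} \<Longrightarrow>
           (\<lambda>x. h N k x i) \<in> borel_measurable \<Omega>"
    and "\<And>k. k \<in> {1..K} \<Longrightarrow>
           AE x in \<Omega>. (\<lambda>N. 1 / real N * (norm2 N (h N k x))\<^sup>2) \<longlonglongrightarrow> chi k"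
  shows "AE x in \<Omega>.
           (\<lambda>N. real N / ln (real N) * \<eta> DBF N x)
              \<longlonglongrightarrow> 2 * real (card S) / (PRF * ln 2)
         \<and> (\<lambda>N. (real N)\<^sup>2 / ln (real N) * \<eta> TLM N x)
              \<longlonglongrightarrow> 6 * real (card S) / (PIT * ln 2)
         \<and> (\<lambda>N. (real N)\<^sup>2 / ln (real N) * \<eta> HDM N x)
              \<longlonglongrightarrow> 6 * real (card S) / (PIT * ln 2)"
proof -
  \<comment> \<open>There are finitely many users, so one null set serves them all. Outside it the
    argument is deterministic, for a fixed sample point \<open>x\<close>.\<close>
  have chan: "AE x in \<Omega>. \<forall>k\<in>{1..K}.
      (\<lambda>N. 1 / real N * (norm2 N (h N k x))\<^sup>2) \<longlonglongrightarrow> chi k"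
    using assms(15) by (subst AE_ball_countable) auto
  have DBF: "(\<lambda>N. circuit_power PLO PRF PIT K M DBF N / real N ^ 1) \<longlonglongrightarrow> PRF"
    by simp real_asymp
  \<comment> \<open>The tuning elements number about \<open>N ^ 2 / 2\<close>, which gives the
    coefficient \<open>PIT / 2\<close>. With \<open>d = 2\<close> the factor
    \<open>(d + 1) / (PIT / 2)\<close> becomes \<open>6 / PIT\<close>; for \<open>DBF\<close>,
    \<open>d = 1\<close> gives \<open>2 / PRF\<close>.\<close>
  have TLM: "(\<lambda>N. circuit_power PLO PRF PIT K M TLM N / real N ^ 2) \<longlonglongrightarrow> PIT / 2"
    by simp real_asymp
  have HDM: "(\<lambda>N. circuit_power PLO PRF PIT K M HDM N / real N ^ 2) \<longlonglongrightarrow> PIT / 2"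
    by simp real_asymp
  from chan show ?thesis
  proof eventually_elim
    case (elim x)
    define w where "w = (\<lambda>N. omega N \<sigma> (\<lambda>k. h N k x))"
    have w: "(\<lambda>N. w N k / real N) \<longlonglongrightarrow> chi k / (\<sigma> k)\<^sup>2" if "k \<in> {1..K}" for k
    proof -
      have "(\<lambda>N. 1 / real N * (norm2 N (h N k x))\<^sup>2 / (\<sigma> k)\<^sup>2) \<longlonglongrightarrow> chi k / (\<sigma> k)\<^sup>2"
        using elim assms(12) that by (intro tendsto_intros) auto
      then show ?thesis by (simp add: w_def omega_def mult.commute)
    qed
    have a: "chi k / (\<sigma> k)\<^sup>2 > 0" if "k \<in> {1..K}" for k
      using assms(12,13) that by (intro divide_pos_pos)
    note lim = eta_opt_tendsto[OF assms(5,6) _ w a, unfolded w_def]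
    show ?case
      using lim[OF _ _ _ DBF] lim[OF _ _ _ TLM] lim[OF _ _ _ HDM] assms(9,11)
      unfolding \<eta>_def by simp
  qed
qed

end
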